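(* For the single-item pricing problem where demand may be non-stationary, the deterministic calendar of Algorithm 6 earns expected revenue at least $\mathsf{OPT}_{\mathrm{LP}}/2$, where $\mathsf{OPT}_{\mathrm{LP}}$ is the optimal value of DLP-N.
   Context: Single-item pricing with non-stationary demand: one item with starting inventory $b$ ($1\le b\le T$) is sold over $T$ periods at prices $p_1,\dots,p_m>0$. If price $p_j$ is offered in period $t$, the demanded quantity is a random variable in $[0,1]$ with mean $q_{tj}$, independent across periods; sales equal the minimum of demand and remaining inventory, earning $p_j$ per unit. The firm may also make no offer in a period (equivalently offer an infinite price with zero demand), which earns nothing. DLP-N: maximize $\sum_t\sum_jp_jq_{tj}x_{tj}$ subject to $\sum_t\sum_jq_{tj}x_{tj}\le b$, $\sum_jx_{tj}\le1$ for all $t$, $x_{tj}\ge0$; let $r^*$ be its optimal value. Algorithm 6: for each period $t$, offer price $p_{j_t}$ with $j_t\in\arg\max_j(p_j-\frac{r^*}{2b})q_{tj}$, where the no-offer option is included in the maximization with value $0$. *)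

theory Defs
  imports "HOL-Probability.Probability"
begin

text \<open>
  Periods are \<open>t < T\<close> and prices are \<open>p j\<close> for \<open>j < m\<close>. An action is a \<open>nat option\<close>: \<open>Some j\<close> offers
  price \<open>p j\<close>, \<open>None\<close> makes no offer. The random variable \<open>D t j\<close> is the quantity demanded in
  period \<open>t\<close> if price \<open>p j\<close> is offered. Nothing is assumed about the joint law of \<open>D t j\<close> and
  \<open>D t k\<close>, since only one price is offered per period; independence across periods is required
  along every choice of one price per period. The inventory \<open>b\<close> need not be an integer.
\<close>

locale single_item_pricing = prob_space M
  for M :: "'a measure" +
  fixes T m :: nat
    and b :: real
    and p :: "nat \<Rightarrow> real"
    and q :: "nat \<Rightarrow> nat \<Rightarrow> real"
    and D :: "nat \<Rightarrow> nat \<Rightarrow> 'a \<Rightarrow> real"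
  assumes inventory: "1 \<le> b" "b \<le> real T"
    and price_pos: "\<And>j. j < m \<Longrightarrow> 0 < p j"
    and demand_rv: "\<And>t j. t < T \<Longrightarrow> j < m \<Longrightarrow> D t j \<in> borel_measurable M"
    and demand_range: "\<And>t j. t < T \<Longrightarrow> j < m \<Longrightarrow> AE \<omega> in M. 0 \<le> D t j \<omega> \<and> D t j \<omega> \<le> 1"
    and demand_mean: "\<And>t j. t < T \<Longrightarrow> j < m \<Longrightarrow> expectation (D t j) = q t j"
    and demand_indep:
      "\<And>k :: nat \<Rightarrow> nat. (\<forall>t<T. k t < m) \<Longrightarrow> indep_vars (\<lambda>_. borel) (\<lambda>t. D t (k t)) {..<T}"

definition actions :: "nat \<Rightarrow> nat option set" where
  "actions m = insert None (Some ` {..<m})"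

definition dlpn_feasible :: "nat \<Rightarrow> nat \<Rightarrow> real \<Rightarrow> (nat \<Rightarrow> nat \<Rightarrow> real) \<Rightarrow> (nat \<Rightarrow> nat \<Rightarrow> real) \<Rightarrow> bool" where
  "dlpn_feasible T m b q x \<longleftrightarrow>
     (\<Sum>t<T. \<Sum>j<m. q t j * x t j) \<le> b \<and>
     (\<forall>t<T. (\<Sum>j<m. x t j) \<le> 1) \<and>
     (\<forall>t<T. \<forall>j<m. 0 \<le> x t j)"

definition dlpn_objective :: "nat \<Rightarrow> nat \<Rightarrow> (nat \<Rightarrow> real) \<Rightarrow> (nat \<Rightarrow> nat \<Rightarrow> real) \<Rightarrow> (nat \<Rightarrow> nat \<Rightarrow> real) \<Rightarrow> real" where
  "dlpn_objective T m p q x = (\<Sum>t<T. \<Sum>j<m. p j * q t j * x t j)"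

definition opt_lp :: "nat \<Rightarrow> nat \<Rightarrow> real \<Rightarrow> (nat \<Rightarrow> real) \<Rightarrow> (nat \<Rightarrow> nat \<Rightarrow> real) \<Rightarrow> real" where
  "opt_lp T m b p q = (SUP x \<in> {x. dlpn_feasible T m b q x}. dlpn_objective T m p q x)"

text \<open>The supremum defining \<open>opt_lp\<close> is over a nonempty set that is bounded above.\<close>

lemma dlpn_feasible_zero: "0 \<le> b \<Longrightarrow> dlpn_feasible T m b q (\<lambda>_ _. 0)"
  by (simp add: dlpn_feasible_def)

lemma dlpn_bdd_above: "bdd_above (dlpn_objective T m p q ` {x. dlpn_feasible T m b q x})"
proof (rule bdd_aboveI2)
  fix x assume "x \<in> {x. dlpn_feasible T m b q x}"
  then have x: "\<And>t. t < T \<Longrightarrow> (\<Sum>j<m. x t j) \<le> 1" "\<And>t j. t < T \<Longrightarrow> j < m \<Longrightarrow> 0 \<le> x t j"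
    by (auto simp: dlpn_feasible_def)
  have x1: "x t j \<le> 1" if "t < T" "j < m" for t j
    using member_le_sum[of j "{..<m}" "x t"] x that by force
  show "dlpn_objective T m p q x \<le> (\<Sum>t<T. \<Sum>j<m. \<bar>p j * q t j\<bar>)"
    unfolding dlpn_objective_def
  proof (intro sum_mono)
    fix t j assume "t \<in> {..<T}" "j \<in> {..<m}"
    then have "0 \<le> x t j" "x t j \<le> 1" using x x1 by auto
    then have "\<bar>p j * q t j\<bar> * x t j \<le> \<bar>p j * q t j\<bar>" by (intro mult_left_le) auto
    moreover have "p j * q t j * x t j \<le> \<bar>p j * q t j\<bar> * x t j"
      using \<open>0 \<le> x t j\<close> by (intro mult_right_mono) auto
    ultimately show "p j * q t j * x t j \<le> \<bar>p j * q t j\<bar>" by linarith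
  qed
qed

fun adjusted_value :: "(nat \<Rightarrow> real) \<Rightarrow> (nat \<Rightarrow> nat \<Rightarrow> real) \<Rightarrow> real \<Rightarrow> nat \<Rightarrow> nat option \<Rightarrow> real" where
  "adjusted_value p q r t None = 0"
| "adjusted_value p q r t (Some j) = (p j - r) * q t j"

text \<open>Ties in the maximization may be broken arbitrarily, hence a predicate on calendars.\<close>

definition threshold_calendar ::
    "nat \<Rightarrow> nat \<Rightarrow> real \<Rightarrow> (nat \<Rightarrow> real) \<Rightarrow> (nat \<Rightarrow> nat \<Rightarrow> real) \<Rightarrow> (nat \<Rightarrow> nat option) \<Rightarrow> bool" where
  "threshold_calendar T m b p q c \<longleftrightarrow>
     (\<forall>t<T. is_arg_max (adjusted_value p q (opt_lp T m b p q / (2 * b)) t) (\<lambda>a. a \<in> actions m) (c t))"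

fun price_of :: "(nat \<Rightarrow> real) \<Rightarrow> nat option \<Rightarrow> real" where
  "price_of p None = 0"
| "price_of p (Some j) = p j"

fun demand_of :: "(nat \<Rightarrow> nat \<Rightarrow> 'a \<Rightarrow> real) \<Rightarrow> nat \<Rightarrow> nat option \<Rightarrow> 'a \<Rightarrow> real" where
  "demand_of D t None \<omega> = 0"
| "demand_of D t (Some j) \<omega> = D t j \<omega>"

text \<open>\<open>stock D b c t\<close> is the inventory remaining at the start of period \<open>t\<close>.\<close>

primrec stock :: "(nat \<Rightarrow> nat \<Rightarrow> 'a \<Rightarrow> real) \<Rightarrow> real \<Rightarrow> (nat \<Rightarrow> nat option) \<Rightarrow> nat \<Rightarrow> 'a \<Rightarrow> real" where
  "stock D b c 0 \<omega> = b"
| "stock D b c (Suc t) \<omega> = stock D b c t \<omega> - min (demand_of D t (c t) \<omega>) (stock D b c t \<omega>)"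

definition sales :: "(nat \<Rightarrow> nat \<Rightarrow> 'a \<Rightarrow> real) \<Rightarrow> real \<Rightarrow> (nat \<Rightarrow> nat option) \<Rightarrow> nat \<Rightarrow> 'a \<Rightarrow> real" where
  "sales D b c t \<omega> = min (demand_of D t (c t) \<omega>) (stock D b c t \<omega>)"

definition revenue ::
    "nat \<Rightarrow> real \<Rightarrow> (nat \<Rightarrow> real) \<Rightarrow> (nat \<Rightarrow> nat \<Rightarrow> 'a \<Rightarrow> real) \<Rightarrow> (nat \<Rightarrow> nat option) \<Rightarrow> 'a \<Rightarrow> real" where
  "revenue T b p D c \<omega> = (\<Sum>t<T. price_of p (c t) * sales D b c t \<omega>)"

end

theory Submission
  imports Defs
begin

text \<open>
  Let \<open>r = OPT / (2b)\<close> and let \<open>v t \<ge> 0\<close> be the maximal adjusted value in period \<open>t\<close>. The prices \<open>r\<close>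
  per unit of inventory and \<open>v t\<close> per period are dual feasible, so \<open>OPT \<le> (\<Sum>t. v t) + r b\<close>, that is
  \<open>(\<Sum>t. v t) \<ge> OPT / 2\<close>. Write \<open>B t\<close> for the stock. As \<open>B t \<le> b\<close> and demand is at most \<open>1 \<le> b\<close>,
  sales in period \<open>t\<close> are at least demand times \<open>B t / b\<close>; demand is independent of \<open>B t\<close>, so the
  sales valued at \<open>price - r\<close> are worth at least \<open>v t * E (B t) / b \<ge> v t * E (B T) / b\<close> in expectation.
  Adding back \<open>r\<close> for each of the \<open>b - B T\<close> units sold, the revenue is at least
  \<open>OPT / 2 * E (B T) / b + r * (b - E (B T)) = OPT / 2\<close>.
\<close>

section \<open>Weak duality for DLP-N\<close>

lemma opt_lp_nonneg:
  assumes "0 \<le> b"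
  shows "0 \<le> opt_lp T m b p q"
proof -
  have "dlpn_objective T m p q (\<lambda>_ _. 0) \<le> opt_lp T m b p q"
    unfolding opt_lp_def
    by (rule cSUP_upper[OF _ dlpn_bdd_above]) (simp add: dlpn_feasible_zero assms)
  then show ?thesis by (simp add: dlpn_objective_def)
qed

text \<open>Split each price as \<open>(p j - r) + r\<close>. The part \<open>p j - r\<close> is
  controlled period by period through \<open>(\<Sum>j<m. x t j) \<le> 1\<close>, the part
  \<open>r\<close> through the capacity constraint.\<close>

lemma opt_lp_le_dual:
  assumes b: "0 \<le> b" and r: "0 \<le> r"
    and v0: "\<And>t. t < T \<Longrightarrow> 0 \<le> v t"
    and v: "\<And>t j. t < T \<Longrightarrow> j < m \<Longrightarrow> (p j - r) * q t j \<le> v t"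
  shows "opt_lp T m b p q \<le> (\<Sum>t<T. v t) + r * b"
  unfolding opt_lp_def
proof (rule cSUP_least)
  show "{x. dlpn_feasible T m b q x} \<noteq> {}"
    using dlpn_feasible_zero[OF b] by blast
next
  fix x assume "x \<in> {x. dlpn_feasible T m b q x}"
  then have cap: "(\<Sum>t<T. \<Sum>j<m. q t j * x t j) \<le> b"
    and x1: "\<And>t. t < T \<Longrightarrow> (\<Sum>j<m. x t j) \<le> 1"
    and x0: "\<And>t j. t < T \<Longrightarrow> j < m \<Longrightarrow> 0 \<le> x t j"
    by (auto simp: dlpn_feasible_def)
  have "(\<Sum>j<m. (p j - r) * q t j * x t j) \<le> v t" if t: "t < T" for t
  proof -
    have "(\<Sum>j<m. (p j - r) * q t j * x t j) \<le> (\<Sum>j<m. v t * x t j)"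
      by (intro sum_mono mult_right_mono) (use t v x0 in auto)
    also have "\<dots> = v t * (\<Sum>j<m. x t j)" by (simp add: sum_distrib_left)
    also have "\<dots> \<le> v t" using v0 x1 t by (intro mult_left_le) auto
    finally show ?thesis .
  qed
  then have "(\<Sum>t<T. \<Sum>j<m. (p j - r) * q t j * x t j) \<le> (\<Sum>t<T. v t)"
    by (intro sum_mono) auto
  moreover have "dlpn_objective T m p q x =
      (\<Sum>t<T. \<Sum>j<m. (p j - r) * q t j * x t j) + r * (\<Sum>t<T. \<Sum>j<m. q t j * x t j)"
    by (simp add: dlpn_objective_def sum_distrib_left sum.distrib[symmetric] algebra_simps)
  moreover have "r * (\<Sum>t<T. \<Sum>j<m. q t j * x t j) \<le> r * b"
    using cap r by (rule mult_left_mono)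
  ultimately show "dlpn_objective T m p q x \<le> (\<Sum>t<T. v t) + r * b" by linarith
qed

section \<open>Pathwise behaviour and measurability of demand and stock\<close>

lemma demand_of_eq:
  "demand_of D t None = (\<lambda>_. 0)"
  "demand_of D t (Some j) = D t j"
  by (simp_all add: fun_eq_iff)

lemma stock_Suc_sales: "stock D b c (Suc t) \<omega> = stock D b c t \<omega> - sales D b c t \<omega>"
  by (simp add: sales_def)

lemma stock_eq_sum_sales: "stock D b c t \<omega> = b - (\<Sum>s<t. sales D b c s \<omega>)"
  by (induction t) (simp_all add: stock_Suc_sales del: stock.simps(2))

lemma stock_bounds:
  assumes "0 \<le> b" and "\<And>s. s < t \<Longrightarrow> 0 \<le> demand_of D s (c s) \<omega>"
  shows "0 \<le> stock D b c t \<omega> \<and> stock D b c t \<omega> \<le> b"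
  using assms(2)
proof (induction t)
  case (Suc t)
  then have "0 \<le> stock D b c t \<omega>" "stock D b c t \<omega> \<le> b" "0 \<le> demand_of D t (c t) \<omega>"
    by auto
  then show ?case by auto
qed (use assms(1) in simp)

text \<open>Kept general in \<open>M\<close>, because it serves both the probability space and a
  product space whose coordinates are past demands.\<close>

lemma measurable_stock:
  assumes "\<And>s. s < t \<Longrightarrow> demand_of D s (c s) \<in> borel_measurable M"
  shows "stock D b c t \<in> borel_measurable M"
  using assms
proof (induction t)
  case (Suc t)
  then have [measurable]: "stock D b c t \<in> borel_measurable M"
      "demand_of D t (c t) \<in> borel_measurable M"
    by auto
  show ?case
    unfolding stock.simps(2)[abs_def] by measurable
qed (simp add: stock.simps(1)[abs_def])

text \<open>The two demand processes may live on different sample spaces; this lets the stock be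
  rebuilt from a vector of past demands.\<close>

lemma stock_cong:
  assumes "\<And>s. s < t \<Longrightarrow> demand_of D s (c s) \<omega> = demand_of D' s (c s) \<omega>'"
  shows "stock D b c t \<omega> = stock D' b c t \<omega>'"
  using assms by (induction t) auto

text \<open>After multiplying by \<open>b\<close>, the bound by \<open>d\<close> is
  \<open>B \<le> b\<close> and the bound by \<open>B\<close> is
  \<open>d \<le> 1 \<le> b\<close>.\<close>

lemma min_ge_mult_div:
  fixes d B b :: real
  assumes "0 \<le> d" "d \<le> 1" "0 \<le> B" "B \<le> b" "1 \<le> b"
  shows "d * B / b \<le> min d B"
proof -
  have "d * B \<le> d * b" using assms by (intro mult_left_mono) auto
  moreover have "d * B \<le> b * B" using assms by (intro mult_right_mono) auto
  ultimately have "d * B \<le> min d B * b" by (auto simp: min_def mult.commute)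
  then show ?thesis by (rule pos_divide_le_eq[THEN iffD2, rotated]) (use assms in simp)
qed

section \<open>Integrability and mean of the demand of one action\<close>

context single_item_pricing
begin

lemma measurable_demand_of:
  assumes "t < T" "a \<in> actions m"
  shows "demand_of D t a \<in> borel_measurable M"
  using assms demand_rv by (cases a) (auto simp: actions_def demand_of_eq)

lemma AE_demand_of:
  assumes "t < T" "a \<in> actions m"
  shows "AE \<omega> in M. 0 \<le> demand_of D t a \<omega> \<and> demand_of D t a \<omega> \<le> 1"
  using assms demand_range by (cases a) (auto simp: actions_def)

lemma adjusted_value_eq:
  assumes "t < T" "a \<in> actions m"
  shows "adjusted_value p q r t a = (price_of p a - r) * expectation (demand_of D t a)"
proof (cases a)
  case (Some j)
  then show ?thesis using assms demand_mean by (auto simp: actions_def demand_of_eq)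
qed (simp add: demand_of_eq)

lemma integrable_demand_of:
  assumes "t < T" "a \<in> actions m"
  shows "integrable M (demand_of D t a)"
  by (rule integrable_const_bound[where B=1])
    (use AE_demand_of[OF assms] measurable_demand_of[OF assms] in auto)

section \<open>Expected stock, sales and revenue of an arbitrary calendar of admissible
  actions\<close>

context
  fixes c :: "nat \<Rightarrow> nat option"
  assumes c: "\<And>t. t < T \<Longrightarrow> c t \<in> actions m"
begin

lemma AE_stock:
  assumes "t \<le> T"
  shows "AE \<omega> in M. 0 \<le> stock D b c t \<omega> \<and> stock D b c t \<omega> \<le> b"
proof -
  have "AE \<omega> in M. \<forall>s\<in>{..<t}. 0 \<le> demand_of D s (c s) \<omega>"
    by (rule AE_finite_allI) (use AE_demand_of c assms in fastforce)+
  then show ?thesis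
    by eventually_elim (use inventory in \<open>auto intro!: stock_bounds\<close>)
qed

lemma integrable_stock:
  assumes "t \<le> T"
  shows "integrable M (stock D b c t)"
proof (rule integrable_const_bound[where B=b])
  show "stock D b c t \<in> borel_measurable M"
    by (rule measurable_stock) (use measurable_demand_of c assms in auto)
  show "AE \<omega> in M. norm (stock D b c t \<omega>) \<le> b"
    using AE_stock[OF assms] by eventually_elim auto
qed

lemma integrable_sales:
  assumes "t < T"
  shows "integrable M (sales D b c t)"
  using integrable_demand_of[OF assms c[OF assms]] integrable_stock[of t] assms
  by (simp add: sales_def[abs_def])

text \<open>\<open>demand_indep\<close> covers only calendars that offer a price in every period.
  Periods without an offer are filled with price index 0, which exists as \<open>0 < m\<close>, and
  the map \<open>Y t\<close> then sends their demand to 0; coordinatewise measurable maps preserve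
  independence.\<close>

lemma indep_demand_of:
  assumes "0 < m"
  shows "indep_vars (\<lambda>_. borel) (\<lambda>t. demand_of D t (c t)) {..<T}"
proof -
  define k where "k t = (case c t of Some j \<Rightarrow> if j < m then j else 0 | None \<Rightarrow> 0)" for t
  define Y where "Y t = (\<lambda>x::real. if c t = None then 0 else x)" for t
  have "\<forall>t<T. k t < m" using assms by (auto simp: k_def split: option.splits)
  then have "indep_vars (\<lambda>_. borel) (\<lambda>t. D t (k t)) {..<T}" by (rule demand_indep)
  then have "indep_vars (\<lambda>_. borel) (\<lambda>t \<omega>. Y t (D t (k t) \<omega>)) {..<T}"
    by (rule indep_vars_compose2) (simp add: Y_def)
  moreover have "Y t (D t (k t) \<omega>) = demand_of D t (c t) \<omega>" if "t < T" for t \<omega>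
    using c[OF that] by (auto simp: Y_def k_def actions_def)
  ultimately show ?thesis
    by (subst indep_vars_cong[where Y="\<lambda>t \<omega>. Y t (D t (k t) \<omega>)"]) auto
qed

text \<open>The stock at the start of period \<open>t\<close> depends only on demands before
  \<open>t\<close>, hence is independent of the demand in \<open>t\<close>. The offer
  \<open>Some j\<close> guarantees \<open>0 < m\<close>.\<close>

lemma expectation_demand_stock_Some:
  assumes t: "t < T" and j: "c t = Some j"
  shows "integrable M (\<lambda>\<omega>. demand_of D t (c t) \<omega> * stock D b c t \<omega>)"
    and "expectation (\<lambda>\<omega>. demand_of D t (c t) \<omega> * stock D b c t \<omega>)
      = expectation (demand_of D t (c t)) * expectation (stock D b c t)"
proof -
  define X where "X s = demand_of D s (c s)" for s
  have m: "0 < m" using c[OF t] j by (auto simp: actions_def)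
  \<comment> \<open>Feeding the coordinates \<open>w s\<close> to \<open>stock\<close> as demands exhibits the stock as a measurable function
    of the demands in the periods before \<open>t\<close>.\<close>
  define D' :: "nat \<Rightarrow> nat \<Rightarrow> (nat \<Rightarrow> real) \<Rightarrow> real" where "D' s j w = w s" for s j w
  \<comment> \<open>The index blocks \<open>{t}\<close> and \<open>{..<t}\<close> are disjoint, so
    the corresponding families of demands are independent.\<close>
  have "indep_var (PiM {t} (\<lambda>_. borel)) (\<lambda>\<omega>. restrict (\<lambda>s. X s \<omega>) {t})
      (PiM {..<t} (\<lambda>_. borel)) (\<lambda>\<omega>. restrict (\<lambda>s. X s \<omega>) {..<t})"
    by (rule indep_var_restrict[where I="{..<T}"]) (use indep_demand_of[OF m] t in \<open>auto simp: X_def\<close>)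
  moreover have "(\<lambda>w. w t) \<in> measurable (PiM {t} (\<lambda>_. borel :: real measure)) borel"
    by measurable
  moreover have "stock D' b c t \<in> borel_measurable (PiM {..<t} (\<lambda>_. borel))"
  proof (rule measurable_stock)
    fix s assume s: "s < t"
    have "demand_of D' s (c s) = (if c s = None then (\<lambda>w. 0) else (\<lambda>w. w s))"
      by (cases "c s") (auto simp: D'_def fun_eq_iff)
    then show "demand_of D' s (c s) \<in> borel_measurable (PiM {..<t} (\<lambda>_. borel))"
      using s by (auto intro: measurable_component_singleton)
  qed
  ultimately have "indep_var borel ((\<lambda>w. w t) \<circ> (\<lambda>\<omega>. restrict (\<lambda>s. X s \<omega>) {t}))
      borel (stock D' b c t \<circ> (\<lambda>\<omega>. restrict (\<lambda>s. X s \<omega>) {..<t}))"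
    by (rule indep_var_compose)
  moreover have "(\<lambda>w. w t) \<circ> (\<lambda>\<omega>. restrict (\<lambda>s. X s \<omega>) {t}) = demand_of D t (c t)"
    by (auto simp: X_def)
  moreover have "stock D' b c t \<circ> (\<lambda>\<omega>. restrict (\<lambda>s. X s \<omega>) {..<t}) = stock D b c t"
  proof
    fix \<omega>
    have "demand_of D' s (c s) (restrict (\<lambda>s. X s \<omega>) {..<t}) = demand_of D s (c s) \<omega>" if "s < t" for s
      using that by (cases "c s") (auto simp: X_def D'_def)
    then show "(stock D' b c t \<circ> (\<lambda>\<omega>. restrict (\<lambda>s. X s \<omega>) {..<t})) \<omega> = stock D b c t \<omega>"
      unfolding comp_def by (rule stock_cong)
  qed
  ultimately have ind: "indep_var borel (demand_of D t (c t)) borel (stock D b c t)"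
    by simp
  note int = integrable_demand_of[OF t c[OF t]] integrable_stock[of t]
  show "integrable M (\<lambda>\<omega>. demand_of D t (c t) \<omega> * stock D b c t \<omega>)"
    by (rule indep_var_integrable[OF ind]) (use int t in auto)
  show "expectation (\<lambda>\<omega>. demand_of D t (c t) \<omega> * stock D b c t \<omega>)
      = expectation (demand_of D t (c t)) * expectation (stock D b c t)"
    by (rule indep_var_lebesgue_integral[OF ind]) (use int t in auto)
qed

lemma expectation_demand_stock:
  assumes "t < T"
  shows "integrable M (\<lambda>\<omega>. demand_of D t (c t) \<omega> * stock D b c t \<omega>)"
    and "expectation (\<lambda>\<omega>. demand_of D t (c t) \<omega> * stock D b c t \<omega>)
      = expectation (demand_of D t (c t)) * expectation (stock D b c t)"
proof -
  have "integrable M (\<lambda>\<omega>. demand_of D t (c t) \<omega> * stock D b c t \<omega>) \<and>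
    expectation (\<lambda>\<omega>. demand_of D t (c t) \<omega> * stock D b c t \<omega>)
      = expectation (demand_of D t (c t)) * expectation (stock D b c t)"
  proof (cases "c t")
    case None
    then show ?thesis by (simp add: demand_of_eq)
  next
    case (Some j)
    then show ?thesis using expectation_demand_stock_Some[OF assms Some] by blast
  qed
  then show "integrable M (\<lambda>\<omega>. demand_of D t (c t) \<omega> * stock D b c t \<omega>)"
    and "expectation (\<lambda>\<omega>. demand_of D t (c t) \<omega> * stock D b c t \<omega>)
      = expectation (demand_of D t (c t)) * expectation (stock D b c t)"
    by auto
qed

text \<open>The lower bound integrates \<open>min_ge_mult_div\<close> and factors the product by
  independence. The upper bound handles prices below the threshold, where more sales lower the
  adjusted value.\<close>

lemma expectation_sales_bounds:
  assumes t: "t < T"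
  shows "expectation (demand_of D t (c t)) * expectation (stock D b c t) / b \<le> expectation (sales D b c t)"
    and "0 \<le> expectation (sales D b c t)"
    and "expectation (sales D b c t) \<le> expectation (demand_of D t (c t))"
proof -
  have AE: "AE \<omega> in M. (0 \<le> demand_of D t (c t) \<omega> \<and> demand_of D t (c t) \<omega> \<le> 1) \<and>
      (0 \<le> stock D b c t \<omega> \<and> stock D b c t \<omega> \<le> b)"
    using AE_demand_of[OF t c[OF t]] AE_stock[of t] t by auto
  have "expectation (\<lambda>\<omega>. demand_of D t (c t) \<omega> * stock D b c t \<omega> / b) \<le> expectation (sales D b c t)"
  proof (rule integral_mono_AE)
    show "AE \<omega> in M. demand_of D t (c t) \<omega> * stock D b c t \<omega> / b \<le> sales D b c t \<omega>"
      using AE unfolding sales_def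
      by eventually_elim (rule min_ge_mult_div, use inventory in auto)
  qed (use expectation_demand_stock(1)[OF t] integrable_sales[OF t] in auto)
  then show "expectation (demand_of D t (c t)) * expectation (stock D b c t) / b \<le> expectation (sales D b c t)"
    by (simp add: expectation_demand_stock(2)[OF t])
  show "0 \<le> expectation (sales D b c t)"
    by (rule integral_nonneg_AE) (use AE in \<open>auto simp: sales_def\<close>)
  show "expectation (sales D b c t) \<le> expectation (demand_of D t (c t))"
    by (rule integral_mono[OF integrable_sales[OF t] integrable_demand_of[OF t c[OF t]]])
      (simp add: sales_def)
qed

lemma expectation_stock:
  assumes "t \<le> T"
  shows "expectation (stock D b c t) = b - (\<Sum>s<t. expectation (sales D b c s))"
proof -
  have "expectation (stock D b c t) = expectation (\<lambda>\<omega>. b - (\<Sum>s<t. sales D b c s \<omega>))"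
    by (rule Bochner_Integration.integral_cong) (auto simp: stock_eq_sum_sales)
  also have "\<dots> = b - expectation (\<lambda>\<omega>. \<Sum>s<t. sales D b c s \<omega>)"
    using assms integrable_sales by (subst Bochner_Integration.integral_diff) (auto simp: prob_space)
  also have "expectation (\<lambda>\<omega>. \<Sum>s<t. sales D b c s \<omega>) = (\<Sum>s<t. expectation (sales D b c s))"
    by (rule Bochner_Integration.integral_sum) (use assms integrable_sales in auto)
  finally show ?thesis .
qed

lemma expectation_stock_mono:
  assumes "t \<le> T"
  shows "expectation (stock D b c T) \<le> expectation (stock D b c t)"
proof -
  have "(\<Sum>s<t. expectation (sales D b c s)) \<le> (\<Sum>s<T. expectation (sales D b c s))"
    by (rule sum_mono2) (use assms expectation_sales_bounds(2) in auto)
  then show ?thesis using assms by (simp add: expectation_stock)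
qed

lemma expectation_revenue:
  "expectation (revenue T b p D c) = (\<Sum>t<T. price_of p (c t) * expectation (sales D b c t))"
  unfolding revenue_def[abs_def] using integrable_sales by (subst Bochner_Integration.integral_sum) auto

lemma adjusted_sales_ge:
  assumes t: "t < T" and v: "0 \<le> adjusted_value p q r t (c t)"
  shows "adjusted_value p q r t (c t) * (expectation (stock D b c T) / b)
    \<le> (price_of p (c t) - r) * expectation (sales D b c t)"
proof -
  let ?d = "expectation (demand_of D t (c t))" and ?B = "expectation (stock D b c t)"
    and ?S = "expectation (sales D b c t)"
  have b: "0 < b" using inventory by simp
  have Bb: "?B \<le> b"
    using t expectation_stock[of t] expectation_sales_bounds(2) by (auto intro: sum_nonneg)
  note eq = adjusted_value_eq[OF t c[OF t], of r]
  note S = expectation_sales_bounds[OF t]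
  have "adjusted_value p q r t (c t) * (expectation (stock D b c T) / b)
      \<le> adjusted_value p q r t (c t) * (?B / b)"
    using expectation_stock_mono[of t] t v b by (intro mult_left_mono divide_right_mono) auto
  also have "\<dots> \<le> (price_of p (c t) - r) * ?S"
  proof (cases "r \<le> price_of p (c t)")
    case True
    then show ?thesis
      using mult_left_mono[OF S(1), of "price_of p (c t) - r"] by (simp add: eq mult.assoc)
  next
    case False
    \<comment> \<open>Here \<open>price_of p (c t) - r\<close> is negative, so the upper bound on
      sales is the useful one. No offer, with price 0, falls under this case when
      \<open>r > 0\<close>.\<close>
    have "adjusted_value p q r t (c t) * (?B / b) \<le> adjusted_value p q r t (c t)"
      using v Bb b by (intro mult_left_le) auto
    also have "\<dots> \<le> (price_of p (c t) - r) * ?S"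
      unfolding eq using S(3) False by (intro mult_left_mono_neg) auto
    finally show ?thesis .
  qed
  finally show ?thesis .
qed

end

end

theorem theorem6:
  fixes M :: "'a measure"
    and T m :: nat
    and b :: real
    and p :: "nat \<Rightarrow> real"
    and q :: "nat \<Rightarrow> nat \<Rightarrow> real"
    and D :: "nat \<Rightarrow> nat \<Rightarrow> 'a \<Rightarrow> real"
    and c :: "nat \<Rightarrow> nat option"
  assumes "single_item_pricing M T m b p q D"
    and "threshold_calendar T m b p q c"
  shows "prob_space.expectation M (revenue T b p D c) \<ge> opt_lp T m b p q / 2"
proof -
  interpret single_item_pricing M T m b p q D by fact
  define r where "r = opt_lp T m b p q / (2 * b)"
  define v where "v t = adjusted_value p q r t (c t)" for t
  have b: "0 < b" using inventory by simp
  have r: "0 \<le> r" using b by (simp add: r_def opt_lp_nonneg)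
  \<comment> \<open>This choice of \<open>r\<close> makes the inventory term of the dual bound
    exactly half the optimum.\<close>
  have rb: "r * b = opt_lp T m b p q / 2" using b by (simp add: r_def)
  have max: "is_arg_max (adjusted_value p q r t) (\<lambda>a. a \<in> actions m) (c t)" if "t < T" for t
    using assms(2) that by (auto simp: threshold_calendar_def r_def)
  then have c: "c t \<in> actions m" if "t < T" for t
    using that by (auto simp: is_arg_max_def)
  have v: "adjusted_value p q r t a \<le> v t" if "t < T" "a \<in> actions m" for t a
    using max[OF that(1)] that(2) by (auto simp: is_arg_max_linorder v_def)
  \<comment> \<open>The no-offer option has value 0 and competes in the maximization.\<close>
  have v0: "0 \<le> v t" if "t < T" for t
    using v[OF that, of None] by (simp add: actions_def)
  have "(p j - r) * q t j \<le> v t" if "t < T" "j < m" for t j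
    using v[of t "Some j"] that by (simp add: actions_def)
  then have "opt_lp T m b p q \<le> (\<Sum>t<T. v t) + r * b"
    using b r v0 by (intro opt_lp_le_dual) auto
  then have dual: "r * b \<le> (\<Sum>t<T. v t)" using rb by linarith
  define E where "E t = expectation (sales D b c t)" for t
  define B where "B = expectation (stock D b c T)"
  have B: "B = b - (\<Sum>t<T. E t)"
    unfolding B_def E_def using c by (intro expectation_stock) auto
  have "0 \<le> B"
    unfolding B_def by (rule integral_nonneg_AE) (use AE_stock[where c=c and t=T] c in auto)
  \<comment> \<open>The left side is \<open>r * B\<close>; it later combines with
    \<open>r * (b - B)\<close>, the value at price \<open>r\<close> of the units expected to be
    sold, to give \<open>r * b\<close>.\<close>
  then have "(r * b) * (B / b) \<le> (\<Sum>t<T. v t) * (B / b)"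
    using dual b by (intro mult_right_mono) auto
  also have "\<dots> \<le> (\<Sum>t<T. (price_of p (c t) - r) * E t)"
    unfolding sum_distrib_right v_def B_def E_def
    using adjusted_sales_ge[where c=c and r=r] c v0 by (intro sum_mono) (auto simp: v_def)
  also have "\<dots> = expectation (revenue T b p D c) - r * (b - B)"
    unfolding B using expectation_revenue[where c=c] c
    by (simp add: E_def left_diff_distrib sum_subtractf sum_distrib_left)
  finally show ?thesis using rb b by (simp add: algebra_simps)
qed

end
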